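(* Let $\mathbb{F}$ be a field with characteristic $2$ and let $n$ be a positive integer. Every trace-zero matrix of $\mathrm{M}_n(\mathbb{F})$ is the sum of three square-zero matrices of $\mathrm{M}_n(\mathbb{F})$.
   Context: $\mathrm{M}_n(\mathbb{F})$ denotes the algebra of all $n \times n$ matrices with entries in $\mathbb{F}$. A matrix $S \in \mathrm{M}_n(\mathbb{F})$ is called square-zero if $S^2=0$ (the zero matrix is allowed). *)

theory Defs
  imports "Jordan_Normal_Form.Matrix"
begin

definition mat_trace :: "'a :: comm_monoid_add mat \<Rightarrow> 'a" where
  "mat_trace A = (\<Sum>i<dim_row A. A $$ (i, i))"

definition square_zero_mat :: "nat \<Rightarrow> 'a :: semiring_0 mat \<Rightarrow> bool" where
  "square_zero_mat n S \<longleftrightarrow> S \<in> carrier_mat n n \<and> S * S = 0\<^sub>m n n"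

end

theory Submission
  imports Defs "Jordan_Normal_Form.Determinant"
begin

text \<open>
  Colour each vector of a basis with one of two colours, \<open>E\<close> and \<open>H\<close>. A matrix whose entries
  vanish whenever row and column have the same colour is the sum of two square-zero matrices, one
  mapping the span of \<open>E\<close> into the span of \<open>H\<close> and killing the latter, the other one the other way
  round. So a trace-zero matrix \<open>A\<close> is a sum of three square-zero matrices as soon as, in a suitable
  coloured basis, some square-zero matrix \<open>S\<close> has the same entries as \<open>A\<close> at all positions of equal
  colours.

  Such a basis is built along a flag of \<open>A\<close>-invariant subspaces. The construction carries an
  excess: on the current subspace, the prescribed entries are those of \<open>S + t e e\<^sup>T\<close> for one vector
  \<open>e\<close> of colour \<open>E\<close>, where \<open>t\<close> is the trace of \<open>A\<close> there. Characteristic 2 is what allows the excess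
  to be passed on: if \<open>h\<close> is a new basis vector of colour \<open>H\<close>, then \<open>t (e + h) (e + h)\<^sup>T\<close> is
  square-zero, since \<open>(e + h)\<^sup>T (e + h) = 2 = 0\<close>; it has the entry \<open>t\<close> both at \<open>(e, e)\<close> and at
  \<open>(h, h)\<close>, while its other two entries are at positions of different colours and do not matter.
  The subspace is enlarged by a whole chain \<open>v, A v, A\<^sup>2 v, \<dots>, h, z\<close> of length at least two, cyclic
  modulo the current subspace and coloured alternately so that \<open>z\<close> has colour \<open>E\<close>. The vector \<open>h\<close>
  absorbs the old excess, and correcting the last vector to \<open>z = A h - S e - t h\<close> produces exactly
  the entries in the column of \<open>h\<close> that this needs. The column of \<open>z\<close> is arbitrary and gives the new
  excess. At the end the excess is the trace of \<open>A\<close>, that is, zero. This step is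
  \<open>linking_append_chain\<close>.

  A chain of length one cannot be treated in this way, so chains of length at least two must
  suffice. They do once the flag starts with a subspace on which \<open>A\<close> is scalar. Indeed, unless \<open>A\<close>
  itself is scalar, some linear functional is not an eigenvector of the transposed action; the
  functionals that it generates under \<open>A\<close> annihilate an invariant subspace whose quotient is cyclic
  of dimension at least two (\<open>nonscalar_similar_shift_rows\<close>). Splitting off cyclic quotients from
  the top therefore ends with a scalar matrix, for which basis vectors are simply matched in pairs
  (\<open>linking_scalar\<close>).
\<close>

section \<open>Square-zero matrices matching the equally coloured entries\<close>

text \<open>
  Here \<open>c i\<close> says that the \<open>i\<close>-th basis vector has colour \<open>E\<close>. The vector \<open>e\<close> is either normalised
  and carries the excess \<open>t\<close>, or it is zero and there is no excess; the second case occurs for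
  scalar matrices of even size, in particular at size zero. The last clause is what makes room for
  the next chain: a vector of colour \<open>E\<close> orthogonal to \<open>e\<close> can be moved into the kernel of \<open>S\<close> by
  adding a vector of colour \<open>H\<close>, which leaves its \<open>E\<close>-coordinates untouched. The vanishing
  trace of \<open>S\<close> is recorded so that \<open>t\<close> is known to be the trace of \<open>M\<close>.
\<close>

definition linking ::
  "nat \<Rightarrow> (nat \<Rightarrow> nat \<Rightarrow> 'a :: field) \<Rightarrow> (nat \<Rightarrow> bool) \<Rightarrow> (nat \<Rightarrow> nat \<Rightarrow> 'a) \<Rightarrow> (nat \<Rightarrow> 'a) \<Rightarrow> 'a \<Rightarrow> bool"
  where "linking n M c S e t \<longleftrightarrow>
    (\<forall>i<n. \<forall>j<n. (\<Sum>l<n. S i l * S l j) = 0) \<and>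
    (\<Sum>i<n. S i i) = 0 \<and>
    (\<forall>j<n. (\<Sum>l<n. e l * S l j) = 0) \<and>
    (\<forall>i<n. \<not> c i \<longrightarrow> e i = 0) \<and>
    ((\<Sum>l<n. e l * e l) = 1 \<or> (\<forall>i<n. e i = 0) \<and> t = 0) \<and>
    (\<forall>i<n. \<forall>j<n. c i = c j \<longrightarrow> M i j = S i j + t * e i * e j) \<and>
    (\<forall>x. (\<forall>i<n. \<not> c i \<longrightarrow> x i = 0) \<longrightarrow> (\<Sum>l<n. e l * x l) = 0 \<longrightarrow>
      (\<exists>y. (\<forall>i<n. c i \<longrightarrow> y i = 0) \<and> (\<forall>i<n. (\<Sum>l<n. S i l * (x l + y l)) = 0)))"

lemma linkingD:
  assumes "linking n M c S e t"
  shows "i < n \<Longrightarrow> j < n \<Longrightarrow> (\<Sum>l<n. S i l * S l j) = 0"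
    and "(\<Sum>i<n. S i i) = 0"
    and "j < n \<Longrightarrow> (\<Sum>l<n. e l * S l j) = 0"
    and "i < n \<Longrightarrow> \<not> c i \<Longrightarrow> e i = 0"
    and "(\<Sum>l<n. e l * e l) = 1 \<or> (\<forall>i<n. e i = 0) \<and> t = 0"
    and "i < n \<Longrightarrow> j < n \<Longrightarrow> c i = c j \<Longrightarrow> M i j = S i j + t * e i * e j"
    and "\<forall>i<n. \<not> c i \<longrightarrow> x i = 0 \<Longrightarrow> (\<Sum>l<n. e l * x l) = 0 \<Longrightarrow>
      \<exists>y. (\<forall>i<n. c i \<longrightarrow> y i = 0) \<and> (\<forall>i<n. (\<Sum>l<n. S i l * (x l + y l)) = 0)"
proof -
  note * = assms[unfolded linking_def]
  note 1 = conjunct1[OF *] and * = conjunct2[OF *]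
  note 2 = conjunct1[OF *] and * = conjunct2[OF *]
  note 3 = conjunct1[OF *] and * = conjunct2[OF *]
  note 4 = conjunct1[OF *] and * = conjunct2[OF *]
  note 5 = conjunct1[OF *] and * = conjunct2[OF *]
  note 6 = conjunct1[OF *] and 7 = conjunct2[OF *]
  show "i < n \<Longrightarrow> j < n \<Longrightarrow> (\<Sum>l<n. S i l * S l j) = 0" using 1 by simp
  show "(\<Sum>i<n. S i i) = 0" by (rule 2)
  show "j < n \<Longrightarrow> (\<Sum>l<n. e l * S l j) = 0" using 3 by simp
  show "i < n \<Longrightarrow> \<not> c i \<Longrightarrow> e i = 0" using 4 by simp
  show "(\<Sum>l<n. e l * e l) = 1 \<or> (\<forall>i<n. e i = 0) \<and> t = 0" by (rule 5)
  show "i < n \<Longrightarrow> j < n \<Longrightarrow> c i = c j \<Longrightarrow> M i j = S i j + t * e i * e j" using 6 by simp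
  show "\<forall>i<n. \<not> c i \<longrightarrow> x i = 0 \<Longrightarrow> (\<Sum>l<n. e l * x l) = 0 \<Longrightarrow>
      \<exists>y. (\<forall>i<n. c i \<longrightarrow> y i = 0) \<and> (\<forall>i<n. (\<Sum>l<n. S i l * (x l + y l)) = 0)"
    using 7 by simp
qed

lemma linking_trace:
  assumes "linking n M c S e t"
  shows "(\<Sum>i<n. M i i) = t"
proof -
  have "(\<Sum>i<n. M i i) = (\<Sum>i<n. S i i + t * (e i * e i))"
    using assms by (intro sum.cong) (auto simp: linking_def mult.assoc)
  also have "\<dots> = t * (\<Sum>i<n. e i * e i)"
    using assms by (simp add: linking_def sum.distrib sum_distrib_left)
  also have "\<dots> = t"
    using assms by (auto simp: linking_def)
  finally show ?thesis .
qed

lemma sum_lessThan_extend_zero: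
  fixes g :: "nat \<Rightarrow> 'a :: comm_monoid_add"
  assumes "m \<le> n" and "\<And>l. m \<le> l \<Longrightarrow> l < n \<Longrightarrow> g l = 0"
  shows "(\<Sum>l<n. g l) = (\<Sum>l<m. g l)"
  using assms by (intro sum.mono_neutral_right) auto

text \<open>
  The matrix is \<open>S (1 + w h\<^sup>T) + t w w\<^sup>T\<close>. When it is squared, only the two cross terms
  \<open>t f w\<^sup>T\<close> survive, one coming from \<open>S w = f\<close> and the other from \<open>h\<^sup>T w = 1\<close>, and they cancel.
  It is used with \<open>w = e + h\<close>.
\<close>

lemma square_zero_absorb_excess:
  fixes S :: "nat \<Rightarrow> nat \<Rightarrow> 'a :: field"
  assumes two: "(2 :: 'a) = 0"
    and SS: "\<And>i j. (\<Sum>l<n. S i l * S l j) = 0"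
    and Sw: "\<And>i. (\<Sum>l<n. S i l * w l) = f i"
    and hS: "\<And>j. (\<Sum>l<n. h l * S l j) = 0"
    and wS: "\<And>j. (\<Sum>l<n. w l * S l j) = 0"
    and hw: "(\<Sum>l<n. h l * w l) = 1"
    and ww: "(\<Sum>l<n. w l * w l) = 0 \<or> t = 0"
  shows "(\<Sum>l<n. (S i l + f i * h l + t * w i * w l) * (S l j + f l * h j + t * w l * w j)) = 0"
proof -
  have Sf: "(\<Sum>l<n. S i l * f l) = 0" for i
  proof -
    have "(\<Sum>l<n. S i l * f l) = (\<Sum>l<n. \<Sum>k<n. S i l * S l k * w k)"
      by (simp add: Sw [symmetric] sum_distrib_left mult.assoc)
    also have "\<dots> = (\<Sum>k<n. (\<Sum>l<n. S i l * S l k) * w k)"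
      by (subst sum.swap) (simp add: sum_distrib_right)
    finally show ?thesis by (simp add: SS)
  qed
  have vf: "(\<Sum>l<n. v l * f l) = 0" if "\<And>j. (\<Sum>l<n. v l * S l j) = 0" for v
  proof -
    have "(\<Sum>l<n. v l * f l) = (\<Sum>l<n. \<Sum>k<n. v l * S l k * w k)"
      by (simp add: Sw [symmetric] sum_distrib_left mult.assoc)
    also have "\<dots> = (\<Sum>k<n. (\<Sum>l<n. v l * S l k) * w k)"
      by (subst sum.swap) (simp add: sum_distrib_right)
    finally show ?thesis by (simp add: that)
  qed
  have "(\<Sum>l<n. (S i l + f i * h l + t * w i * w l) * (S l j + f l * h j + t * w l * w j)) =
      (\<Sum>l<n. S i l * S l j) + (\<Sum>l<n. S i l * f l) * h j + t * w j * (\<Sum>l<n. S i l * w l)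
      + f i * (\<Sum>l<n. h l * S l j) + f i * h j * (\<Sum>l<n. h l * f l) + f i * t * w j * (\<Sum>l<n. h l * w l)
      + t * w i * (\<Sum>l<n. w l * S l j) + t * w i * h j * (\<Sum>l<n. w l * f l)
      + t * w i * w j * (t * (\<Sum>l<n. w l * w l))"
    by (simp add: sum_distrib_left sum_distrib_right sum.distrib algebra_simps)
  also have "\<dots> = 2 * (f i * t * w j)"
    using ww unfolding SS Sf Sw hS wS vf[OF hS] vf[OF wS] hw by auto
  finally show ?thesis by (simp add: two)
qed

text \<open>
  The new basis vectors are the indices \<open>p, \<dots>, h, h + 1\<close>. The hypothesis \<open>top\<close> describes the column
  of \<open>h\<close> after the last vector of the chain has been corrected by \<open>S e + t h\<close>.

  The new square-zero matrix is \<open>S + (S e) h\<^sup>T + t (e + h) (e + h)\<^sup>T + r z\<^sup>T\<close>. Up to the last summand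
  it sends \<open>e\<close> and \<open>h\<close> to the same vector, so the old vector \<open>e\<close>, too, can now be moved into the
  kernel by adding a vector of colour \<open>H\<close>. For this reason the \<open>E\<close>-part of the column of \<open>z\<close>, without
  its entry at \<open>z\<close>, can be completed to a kernel vector \<open>r\<close>, and adding \<open>r z\<^sup>T\<close> preserves square
  zero.
\<close>

lemma linking_append_chain:
  fixes M N S :: "nat \<Rightarrow> nat \<Rightarrow> 'a :: field"
  assumes two: "(2 :: 'a) = 0"
    and link: "linking p M c S e t"
    and ph: "p \<le> h"
    and NM: "\<And>i j. i < p \<Longrightarrow> j < p \<Longrightarrow> N i j = M i j"
    and N0: "\<And>i j. p \<le> i \<Longrightarrow> i < h + 2 \<Longrightarrow> j < p \<Longrightarrow> N i j = 0"
    and chain: "\<And>i j. i < h + 2 \<Longrightarrow> p \<le> j \<Longrightarrow> j < h \<Longrightarrow> N i j = of_bool (i = Suc j)"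
    and top: "\<And>i. i < h + 2 \<Longrightarrow> N i h =
      (if i < p then \<Sum>l<p. S i l * e l else t * of_bool (i = h) + of_bool (i = Suc h))"
  shows "\<exists>c' S' e' t'. linking (h + 2) N c' S' e' t'"
proof -
  define n where "n = h + 2"
  define z where "z = Suc h"
  define c' where "c' i = (if i < p then c i else even (z - i))" for i
  \<comment> \<open>\<open>P\<close> and \<open>d\<close> are \<open>S\<close> and \<open>e\<close> extended by zero, \<open>hv\<close> and \<open>zv\<close> the unit vectors at \<open>h\<close> and \<open>z\<close>.\<close>
  define P where "P i j = (if i < p \<and> j < p then S i j else 0)" for i j
  define d where "d i = (if i < p then e i else 0)" for i
  define hv where "hv i = (of_bool (i = h) :: 'a)" for i
  define zv where "zv i = (of_bool (i = z) :: 'a)" for i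
  define w where "w i = d i + hv i" for i
  define f where "f i = (if i < p then \<Sum>l<p. S i l * e l else 0)" for i
  define R where "R i j = P i j + f i * hv j + t * w i * w j" for i j
  note L = linkingD[OF link]
  have zn: "z < n" "h < n" "p < n" "p \<le> n" "h < z" "p \<le> z" using ph by (auto simp: n_def z_def)
  have c'h: "\<not> c' h" "c' z" using ph by (auto simp: c'_def z_def)
  have sum_p: "(\<Sum>l<n. g l) = (\<Sum>l<p. g l)" if "\<And>l. p \<le> l \<Longrightarrow> g l = 0" for g :: "nat \<Rightarrow> 'a"
    using that zn by (intro sum_lessThan_extend_zero) auto
  have PP: "(\<Sum>l<n. P i l * P l j) = 0" for i j
    by (subst sum_p) (cases "i < p"; cases "j < p"; use L(1)[of i j] in \<open>auto simp: P_def\<close>)+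
  have dP: "(\<Sum>l<n. d l * P l j) = 0" for j
    by (subst sum_p) (cases "j < p"; use L(3)[of j] in \<open>auto simp: P_def d_def\<close>)+
  have hsum: "(\<Sum>l<n. hv l * g l) = g h" "(\<Sum>l<n. g l * hv l) = g h" for g
    using zn by (simp_all add: hv_def if_distrib cong: if_cong)
  have zsum: "(\<Sum>l<n. zv l * g l) = g z" "(\<Sum>l<n. g l * zv l) = g z" for g
    using zn by (simp_all add: zv_def if_distrib cong: if_cong)
  have Pd: "(\<Sum>l<n. P i l * d l) = f i" for i
    by (subst sum_p) (auto simp: P_def d_def f_def)
  have dd: "(\<Sum>l<n. d l * d l) = (\<Sum>l<p. e l * e l)"
    by (subst sum_p) (auto simp: d_def)
  have Ph: "P i h = 0" "P h i = 0" "P i z = 0" "P z i = 0" "d h = 0" "d z = 0" for i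
    using ph by (auto simp: P_def d_def z_def)
  have hh: "hv h = 1" "hv z = 0" "f z = 0" "f h = 0" "w z = 0" "w h = 1"
    using ph by (auto simp: hv_def z_def f_def w_def d_def)
  have Pw: "(\<Sum>l<n. P i l * w l) = f i" for i
    by (simp add: w_def distrib_left sum.distrib Pd hsum Ph)
  have wP: "(\<Sum>l<n. w l * P l j) = 0" for j
    by (simp add: w_def distrib_right sum.distrib dP hsum Ph)
  have ww: "(\<Sum>l<n. w l * w l) = (\<Sum>l<p. e l * e l) + 1"
    by (simp add: w_def distrib_left distrib_right sum.distrib dd hsum Ph hh two)
  have ww0: "(\<Sum>l<n. w l * w l) = 0 \<or> t = 0"
    using L(5) two by (auto simp: ww)
  have RR: "(\<Sum>l<n. R i l * R l j) = 0" for i j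
    unfolding R_def
    by (rule square_zero_absorb_excess[OF two PP Pw _ wP _ ww0]) (simp_all add: hsum Ph hh)
  have Rz: "R i z = 0" "R z i = 0" for i
    by (simp_all add: R_def Ph hh)
  have Rtrace: "(\<Sum>i<n. R i i) = 0"
  proof -
    have "(\<Sum>i<n. P i i) = 0" by (subst sum_p) (use L(2) in \<open>auto simp: P_def\<close>)
    moreover have "(\<Sum>i<n. f i * hv i) = 0" by (simp add: hsum hh)
    moreover have "(\<Sum>i<n. t * w i * w i) = t * (\<Sum>i<n. w i * w i)"
      by (simp add: sum_distrib_left mult.assoc)
    ultimately show ?thesis using ww0 by (auto simp: R_def sum.distrib)
  qed
  have Rv: "(\<Sum>l<n. R i l * v l) = (\<Sum>l<p. P i l * v l) + f i * v h + t * w i * (\<Sum>l<p. e l * v l) + t * w i * v h"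
    for i v
  proof -
    have "(\<Sum>l<n. P i l * v l) = (\<Sum>l<p. P i l * v l)"
      by (rule sum_p) (auto simp: P_def)
    moreover have "(\<Sum>l<n. d l * v l) = (\<Sum>l<p. e l * v l)"
      by (subst sum_p) (auto simp: d_def)
    ultimately show ?thesis
      by (simp add: R_def w_def distrib_right distrib_left sum.distrib mult.assoc hsum
          sum_distrib_left[symmetric])
  qed
  \<comment> \<open>Split off the \<open>e\<close>-component \<open>a e\<close> of \<open>x\<close>: the old matrix handles the rest, and \<open>a h\<close> has the
    same image under \<open>R\<close> as \<open>a e\<close>.\<close>
  have reach: "\<exists>y. (\<forall>i<n. c' i \<longrightarrow> y i = 0) \<and> (\<forall>i<n. (\<Sum>l<n. R i l * (x l + y l)) = 0)"
    if x: "\<forall>i<n. \<not> c' i \<longrightarrow> x i = 0" for x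
  proof -
    define a where "a = (\<Sum>l<p. e l * x l)"
    define x' where "x' i = x i - a * e i" for i
    have xc: "\<not> c i \<Longrightarrow> i < p \<Longrightarrow> x i = 0" for i using x zn by (auto simp: c'_def)
    have ex': "(\<Sum>l<p. e l * x' l) = 0"
    proof -
      have "(\<Sum>l<p. e l * x' l) = a - a * (\<Sum>l<p. e l * e l)"
        by (simp add: x'_def right_diff_distrib sum_subtractf mult.left_commute[of _ a]
            sum_distrib_left[symmetric] flip: a_def)
      thus ?thesis using L(5) by (auto simp: a_def)
    qed
    have "\<forall>i<p. \<not> c i \<longrightarrow> x' i = 0" using xc L(4) by (auto simp: x'_def)
    from L(7)[OF this ex'] obtain y where y: "\<forall>i<p. c i \<longrightarrow> y i = 0"
      and Sy: "\<forall>i<p. (\<Sum>l<p. S i l * (x' l + y l)) = 0" by blast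
    define y' where "y' i = (if i < p then y i else a * hv i)" for i
    have "c' i \<longrightarrow> y' i = 0" for i
      using y c'h by (auto simp: c'_def y'_def hv_def)
    moreover have "(\<Sum>l<n. R i l * (x l + y' l)) = 0" for i
    proof -
      have xh: "x h = 0" and y'h: "y' h = a"
        using x c'h zn ph by (auto simp: y'_def hh)
      have ey: "(\<Sum>l<p. e l * y' l) = 0"
        using y L(4) by (intro sum.neutral) (auto simp: y'_def)
      have "(\<Sum>l<p. P i l * (x l + y' l)) = (\<Sum>l<p. P i l * (x' l + y l)) + a * (\<Sum>l<p. P i l * e l)"
        by (simp add: x'_def y'_def sum_distrib_left sum.distrib[symmetric] algebra_simps)
      also have "(\<Sum>l<p. P i l * (x' l + y l)) = 0"
        using Sy by (cases "i < p") (auto simp: P_def)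
      also have "(\<Sum>l<p. P i l * e l) = f i" by (auto simp: P_def f_def)
      finally have 1: "(\<Sum>l<p. P i l * (x l + y' l)) = a * f i" by simp
      have 2: "(\<Sum>l<p. e l * (x l + y' l)) = a"
        by (simp add: distrib_left sum.distrib ey a_def)
      have "(\<Sum>l<n. R i l * (x l + y' l)) = 2 * (a * f i) + 2 * (t * w i * a)"
        unfolding Rv 1 2 xh y'h by (simp add: algebra_simps)
      thus ?thesis by (simp add: two)
    qed
    ultimately show ?thesis by blast
  qed
  \<comment> \<open>The entry at \<open>(z, z)\<close> is left out, because it becomes the new excess.\<close>
  define x where "x i = (if c' i \<and> i \<noteq> z then N i z else 0)" for i
  have "\<forall>i<n. \<not> c' i \<longrightarrow> x i = 0" by (simp add: x_def)
  from reach[OF this] obtain y where y: "\<forall>i<n. c' i \<longrightarrow> y i = 0"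
    and Ry: "\<forall>i<n. (\<Sum>l<n. R i l * (x l + y l)) = 0" by blast
  define r where "r i = x i + y i" for i
  have rz: "r z = 0" using y c'h zn by (simp add: r_def x_def)
  define S' where "S' i j = R i j + r i * zv j" for i j
  have S'v: "(\<Sum>l<n. S' i l * v l) = (\<Sum>l<n. R i l * v l) + r i * v z" for i v
    by (simp add: S'_def distrib_right sum.distrib mult.assoc sum_distrib_left[symmetric] zsum)
  have "(\<Sum>l<n. S' i l * S' l j) = 0" if "i < n" for i j
  proof -
    have "(\<Sum>l<n. R i l * S' l j) = (\<Sum>l<n. R i l * R l j) + (\<Sum>l<n. R i l * r l) * zv j"
      by (simp add: S'_def distrib_left sum.distrib mult.assoc sum_distrib_right)
    also have "\<dots> = 0" using Ry that by (simp add: RR r_def)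
    finally show ?thesis by (simp add: S'v) (simp add: S'_def Rz rz)
  qed
  moreover have "(\<Sum>i<n. S' i i) = 0"
    by (simp add: S'_def sum.distrib Rtrace zsum rz)
  moreover have "(\<Sum>l<n. zv l * S' l j) = 0" for j
    by (simp add: zsum S'_def Rz rz)
  moreover have "\<not> c' i \<longrightarrow> zv i = 0" for i using c'h by (auto simp: zv_def)
  moreover have "(\<Sum>l<n. zv l * zv l) = 1" by (simp add: zsum) (simp add: zv_def)
  moreover have "N i j = S' i j + N z z * zv i * zv j"
    if ij: "i < n" "j < n" and cc: "c' i = c' j" for i j
  proof -
    consider "j < p" | "p \<le> j" "j < h" | "j = h" | "j = z" using ij by (force simp: n_def z_def)
    then show ?thesis
    proof cases
      case 1
      hence [simp]: "zv j = 0" "hv j = 0" using ph by (auto simp: zv_def hv_def z_def)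
      show ?thesis
      proof (cases "i < p")
        case True
        hence "hv i = 0" using ph by (auto simp: hv_def)
        thus ?thesis using True 1 NM[OF True 1] L(6)[OF True 1] cc
          by (auto simp: S'_def R_def P_def w_def d_def c'_def)
      next
        case False
        hence "N i j = 0" using N0 ij 1 by (simp add: n_def)
        moreover have "w i * w j = 0"
        proof (cases "i = h")
          case True
          hence "\<not> c j" using cc c'h 1 by (auto simp: c'_def)
          hence "e j = 0" using L(4) 1 by auto
          thus ?thesis by (simp add: w_def d_def)
        qed (use False in \<open>simp add: w_def d_def hv_def\<close>)
        ultimately show ?thesis using False by (simp add: S'_def R_def P_def mult.assoc)
      qed
    next
      case 2
      hence "i \<noteq> Suc j" using cc ph by (auto simp: c'_def z_def Suc_diff_le)
      hence "N i j = 0" using chain ij 2 by (simp add: n_def)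
      thus ?thesis using 2 by (simp add: S'_def R_def P_def w_def d_def hv_def zv_def z_def)
    next
      case 3
      hence nc: "\<not> c' i" using cc c'h by simp
      hence "i \<noteq> z" using c'h by auto
      have "e i = 0" if "i < p" using nc that L(4) by (auto simp: c'_def)
      hence "w i = hv i" by (simp add: w_def d_def)
      thus ?thesis using 3 top[of i] ij \<open>i \<noteq> z\<close> Ph hh ph
        by (auto simp: S'_def R_def f_def zv_def n_def z_def hv_def)
    next
      case 4
      hence "c' i" using cc c'h by simp
      hence "r i = (if i = z then 0 else N i z)" using y ij by (simp add: r_def x_def)
      thus ?thesis using 4 by (simp add: S'_def Rz zv_def)
    qed
  qed
  moreover have "\<exists>y. (\<forall>i<n. c' i \<longrightarrow> y i = 0) \<and> (\<forall>i<n. (\<Sum>l<n. S' i l * (x l + y l)) = 0)"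
    if "\<forall>i<n. \<not> c' i \<longrightarrow> x i = 0" "(\<Sum>l<n. zv l * x l) = 0" for x
  proof -
    from reach[OF that(1)] obtain y where y: "\<forall>i<n. c' i \<longrightarrow> y i = 0"
      and Ry: "\<forall>i<n. (\<Sum>l<n. R i l * (x l + y l)) = 0" by blast
    have "x z = 0" using that(2) by (simp add: zsum)
    moreover have "y z = 0" using y c'h zn by simp
    ultimately show ?thesis using y Ry by (intro exI[of _ y]) (simp add: S'v)
  qed
  ultimately have "linking n N c' S' zv (N z z)"
    unfolding linking_def by blast
  thus ?thesis unfolding n_def by blast
qed

text \<open>
  Two eigenvectors of the same eigenvalue \<open>a\<close>, given different colours, are matched by the
  square-zero two-by-two matrix all of whose entries are \<open>a\<close>. When the size is odd, one vector
  remains and carries the excess \<open>a\<close>.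
\<close>

lemma linking_scalar:
  fixes a :: "'a :: field"
  assumes two: "(2 :: 'a) = 0"
  shows "\<exists>c S e t. linking n (\<lambda>i j. a * of_bool (i = j)) c S e t"
proof (induction n rule: nat_less_induct)
  case (1 n)
  consider "n = 0" | "n = 1" | p where "n = p + 2"
    by (metis One_nat_def add_2_eq_Suc' not0_implies_Suc)
  then show ?case
  proof cases
    case 1
    thus ?thesis by (auto simp: linking_def)
  next
    case 2
    have "linking 1 (\<lambda>i j. a * of_bool (i = j)) (\<lambda>_. True) (\<lambda>_ _. 0) (\<lambda>_. 1) a"
      by (auto simp: linking_def)
    with 2 show ?thesis by blast
  next
    case (3 p)
    with 1 obtain c S e t where link: "linking p (\<lambda>i j. a * of_bool (i = j)) c S e t" by force
    note L = linkingD[OF link]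
    \<comment> \<open>The indices \<open>p\<close> and \<open>p + 1\<close> form the new pair, with colours \<open>E\<close> and \<open>H\<close>.\<close>
    define c' where "c' i = (if i < p then c i else i = p)" for i
    define S' where "S' i j = (if i < p \<and> j < p then S i j else if p \<le> i \<and> p \<le> j then a else 0)" for i j
    define e' where "e' i = (if i < p then e i else 0)" for i
    have sum2: "(\<Sum>l<n. g l) = (\<Sum>l<p. g l) + g p + g (Suc p)" for g :: "nat \<Rightarrow> 'a"
      by (simp add: 3)
    have aa: "b + b = 0" "b * b + b * b = 0" for b :: 'a using two by (metis mult_2 mult_zero_left)+
    have "(\<Sum>l<n. S' i l * S' l j) = 0" for i j
      unfolding sum2 using L(1)[of i j] by (cases "i < p"; cases "j < p") (auto simp: S'_def aa two)
    moreover have "(\<Sum>i<n. S' i i) = 0"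
      unfolding sum2 using L(2) by (simp add: S'_def add.assoc aa)
    moreover have "(\<Sum>l<n. e' l * S' l j) = 0" for j
      unfolding sum2 using L(3)[of j] by (cases "j < p") (simp_all add: S'_def e'_def)
    moreover have "\<forall>i<n. \<not> c' i \<longrightarrow> e' i = 0" using L(4) by (auto simp: c'_def e'_def)
    moreover have "(\<Sum>l<n. e' l * e' l) = 1 \<or> (\<forall>i<n. e' i = 0) \<and> t = 0"
      unfolding sum2 using L(5) 3 by (auto simp: e'_def)
    moreover have "a * of_bool (i = j) = S' i j + t * e' i * e' j"
      if "i < n" "j < n" "c' i = c' j" for i j
    proof (cases "i < p \<and> j < p")
      case True
      with L(6)[of i j] that show ?thesis by (auto simp: S'_def e'_def c'_def)
    next
      case False
      with that 3 show ?thesis by (auto simp: S'_def e'_def c'_def less_Suc_eq split: if_splits)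
    qed
    moreover have "\<exists>y. (\<forall>i<n. c' i \<longrightarrow> y i = 0) \<and> (\<forall>i<n. (\<Sum>l<n. S' i l * (x l + y l)) = 0)"
      if x: "\<forall>i<n. \<not> c' i \<longrightarrow> x i = 0" "(\<Sum>l<n. e' l * x l) = 0" for x
    proof -
      have "\<forall>i<p. \<not> c i \<longrightarrow> x i = 0" using x 3 by (auto simp: c'_def)
      moreover have "(\<Sum>l<p. e l * x l) = 0" using x(2) unfolding sum2 by (simp add: e'_def)
      ultimately have "\<exists>y. (\<forall>i<p. c i \<longrightarrow> y i = 0) \<and> (\<forall>i<p. (\<Sum>l<p. S i l * (x l + y l)) = 0)"
        by (rule L(7))
      then obtain y where y: "\<forall>i<p. c i \<longrightarrow> y i = 0"
        and Sy: "\<forall>i<p. (\<Sum>l<p. S i l * (x l + y l)) = 0" by blast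
      define y' where "y' i = (if i < p then y i else if i = p then 0 else x p)" for i
      have "x (Suc p) = 0" using x 3 by (auto simp: c'_def)
      hence "(\<Sum>l<n. S' i l * (x l + y' l)) = 0" for i
        unfolding sum2 using Sy by (cases "i < p") (auto simp: S'_def y'_def aa two)
      moreover have "\<forall>i<n. c' i \<longrightarrow> y' i = 0" using y by (auto simp: c'_def y'_def)
      ultimately show ?thesis by blast
    qed
    ultimately have "linking n (\<lambda>i j. a * of_bool (i = j)) c' S' e' t"
      unfolding linking_def by blast
    thus ?thesis by blast
  qed
qed

section \<open>Splitting off a cyclic quotient of dimension at least two\<close>

lemma invertible_if_trivial_kernel:
  fixes Q :: "'a :: field mat"
  assumes Q: "Q \<in> carrier_mat n n"
    and ker: "\<And>x. x \<in> carrier_vec n \<Longrightarrow> Q *\<^sub>v x = 0\<^sub>v n \<Longrightarrow> x = 0\<^sub>v n"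
  obtains R where "R \<in> carrier_mat n n" "Q * R = 1\<^sub>m n" "R * Q = 1\<^sub>m n"
proof -
  have "det Q \<noteq> 0"
    using ker det_0_iff_vec_prod_zero_field[OF Q] by blast
  hence "Q \<in> Units (ring_mat TYPE('a) n ())" by (rule det_non_zero_imp_unit[OF Q])
  thus thesis using that unfolding Units_def ring_mat_def by auto
qed

text \<open>
  The rows of an invertible matrix are a basis of linear functionals. By exchange, \<open>w\<close> can replace
  the \<open>q\<close>-th coordinate functional; it is put at position \<open>m\<close>, and the \<open>m\<close>-th coordinate functional
  moves to position \<open>q\<close>.
\<close>

lemma extend_row_to_invertible:
  fixes w :: "'a :: field vec"
  assumes w: "w \<in> carrier_vec n" "w $ q \<noteq> 0" and q: "q < n" and m: "m < n"
  obtains Q R where "Q \<in> carrier_mat n n" "R \<in> carrier_mat n n" "Q * R = 1\<^sub>m n" "R * Q = 1\<^sub>m n"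
    "row Q m = w" "\<And>i. i < n \<Longrightarrow> i \<noteq> m \<Longrightarrow> i \<noteq> q \<Longrightarrow> row Q i = unit_vec n i"
proof -
  define f where "f i = (if i = m then w else unit_vec n (if i = q then m else i))" for i
  define Q where "Q = mat_of_rows n (map f [0..<n])"
  have Q: "Q \<in> carrier_mat n n" by (simp add: Q_def mat_of_rows_def)
  have rowQ: "row Q i = f i" if "i < n" for i
    using that w m by (simp add: Q_def f_def)
  have "x = 0\<^sub>v n" if x: "x \<in> carrier_vec n" and Qx: "Q *\<^sub>v x = 0\<^sub>v n" for x
  proof -
    have fx: "f i \<bullet> x = 0" if "i < n" for i
      using arg_cong[OF Qx, of "\<lambda>v. v $ i"] that Q rowQ[OF that] by simp
    have off: "x $ i = 0" if "i < n" "i \<noteq> q" for i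
    proof (cases "i = m")
      case True
      thus ?thesis using fx[of q] that q x by (simp add: f_def)
    next
      case False
      thus ?thesis using fx[of i] that x by (simp add: f_def)
    qed
    have "w \<bullet> x = (\<Sum>i\<in>{0..<n}. w $ i * x $ i)" using x by (simp add: scalar_prod_def)
    also have "\<dots> = (\<Sum>i\<in>{q}. w $ i * x $ i)"
      using off q by (intro sum.mono_neutral_right) auto
    finally have "x $ q = 0" using fx[OF m] w by (simp add: f_def)
    hence "x $ i = 0" if "i < n" for i using off that by (cases "i = q") auto
    with x show ?thesis by (intro eq_vecI) auto
  qed
  from invertible_if_trivial_kernel[OF Q this] obtain R
    where "R \<in> carrier_mat n n" "Q * R = 1\<^sub>m n" "R * Q = 1\<^sub>m n" by blast
  thus thesis using that[of Q R] Q rowQ m by (simp add: f_def)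
qed

lemma similar_mat_conj:
  fixes A :: "'a :: semiring_1 mat"
  assumes "A \<in> carrier_mat n n" "P \<in> carrier_mat n n" "R \<in> carrier_mat n n"
    and "P * R = 1\<^sub>m n" "R * P = 1\<^sub>m n"
  shows "similar_mat A (R * A * P)"
proof (rule similar_matI)
  have "P * (R * A * P) * R = (P * R) * A * (P * R)"
    using assms(1-3) by (simp add: assoc_mult_mat[of _ n n _ n _ n])
  thus "A = P * (R * A * P) * R" using assms by simp
qed (use assms in auto)

lemma row_mult_cong:
  assumes "A \<in> carrier_mat n m" "B \<in> carrier_mat n m" "i < n" "k < n" "row A i = row B k"
  shows "row (A * C) i = row (B * C) k"
  using assms by (intro eq_vecI) auto

lemma row_mult_unit:
  fixes Q :: "'a :: semiring_1 mat"
  assumes "Q \<in> carrier_mat n n" "A \<in> carrier_mat n n" "i < n" "k < n" "row Q i = unit_vec n k"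
  shows "row (Q * A) i = row A k"
  using assms by (intro eq_vecI) auto

text \<open>
  In terms of functionals: applying \<open>M\<close> to the last functional of the dual basis gives the
  previous one, and so on upwards, until the \<open>p\<close>-th functional is reached. If moreover row \<open>p\<close>
  vanishes to the left of its diagonal entry, these functionals span a cyclic invariant space, and
  the first \<open>p\<close> basis vectors span an invariant subspace.
\<close>

definition shift_rows_below :: "nat \<Rightarrow> 'a :: zero_neq_one mat \<Rightarrow> nat \<Rightarrow> bool"
  where "shift_rows_below n M p \<longleftrightarrow> (\<forall>i. p < i \<longrightarrow> i < n \<longrightarrow> row M i = unit_vec n (i - 1))"

lemma shift_rows_belowD:
  assumes "shift_rows_below n M p" "p < i" "i < n"
  shows "row M i = unit_vec n (i - 1)"
  using assms by (simp add: shift_rows_below_def)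

text \<open>
  The functional in row \<open>p + 1\<close> of \<open>M\<close> is made the \<open>p\<close>-th member of the dual basis. The entry at
  \<open>q \<le> p\<close> is what makes it independent of the functionals already in the chain.
\<close>

lemma extend_shift_rows:
  fixes M :: "'a :: field mat"
  assumes M: "M \<in> carrier_mat n n" and p: "Suc p < n" and q: "q \<le> p"
    and nz: "M $$ (Suc p, q) \<noteq> 0" and shift: "shift_rows_below n M (Suc p)"
  shows "\<exists>N\<in>carrier_mat n n. similar_mat M N \<and> shift_rows_below n N p"
proof -
  have w: "row M (Suc p) \<in> carrier_vec n" "row M (Suc p) $ q \<noteq> 0" using M p q nz by auto
  have "q < n" "p < n" using p q by auto
  then obtain Q R where Q: "Q \<in> carrier_mat n n"
    and R: "R \<in> carrier_mat n n" and QR: "Q * R = 1\<^sub>m n" "R * Q = 1\<^sub>m n"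
    and Qp: "row Q p = row M (Suc p)"
    and Qi: "\<And>i. i < n \<Longrightarrow> i \<noteq> p \<Longrightarrow> i \<noteq> q \<Longrightarrow> row Q i = unit_vec n i"
    using extend_row_to_invertible[OF w] by metis
  have "row (Q * M * R) i = unit_vec n (i - 1)" if i: "p < i" "i < n" for i
  proof -
    have "row Q i = unit_vec n i" using i q by (intro Qi) auto
    hence "row (Q * M) i = row M i" using Q M i by (intro row_mult_unit) auto
    also have "\<dots> = row Q (i - 1)"
    proof (cases "i = Suc p")
      case False
      hence "row M i = unit_vec n (i - 1)" using shift i by (simp add: shift_rows_below_def)
      moreover have "row Q (i - 1) = unit_vec n (i - 1)" using False i q by (intro Qi) auto
      ultimately show ?thesis by simp
    qed (simp add: Qp)
    finally have "row (Q * M) i = row Q (i - 1)" .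
    hence "row (Q * M * R) i = row (Q * R) (i - 1)"
      using Q M i by (intro row_mult_cong[of _ n n]) auto
    thus ?thesis using QR i by simp
  qed
  moreover have "similar_mat M (Q * M * R)" by (rule similar_mat_conj[OF M R Q QR(2,1)])
  ultimately show ?thesis
    using Q M R by (intro bexI[of _ "Q * M * R"]) (simp_all add: shift_rows_below_def)
qed

lemma complete_shift_rows:
  fixes M :: "'a :: field mat"
  assumes "M \<in> carrier_mat n n" and "p < n" and "shift_rows_below n M p"
  shows "\<exists>N\<in>carrier_mat n n. \<exists>r\<le>p. similar_mat M N \<and> shift_rows_below n N r \<and>
    (\<forall>j<r. N $$ (r, j) = 0)"
  using assms
proof (induction p arbitrary: M)
  case 0
  thus ?case using similar_mat_refl[OF 0(1)] by (intro bexI[of _ M] exI[of _ 0]) auto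
next
  case (Suc p)
  show ?case
  proof (cases "\<forall>j<Suc p. M $$ (Suc p, j) = 0")
    case True
    thus ?thesis using Suc.prems similar_mat_refl[OF Suc.prems(1)]
      by (intro bexI[of _ M] exI[of _ "Suc p"]) auto
  next
    case False
    then obtain q where "q \<le> p" "M $$ (Suc p, q) \<noteq> 0" by (auto simp: less_Suc_eq_le)
    then obtain L where L: "L \<in> carrier_mat n n" "similar_mat M L" "shift_rows_below n L p"
      using extend_shift_rows[OF Suc.prems(1,2) _ _ Suc.prems(3)] by blast
    obtain N r where N: "N \<in> carrier_mat n n" "r \<le> p" "similar_mat L N"
      "shift_rows_below n N r" "\<forall>j<r. N $$ (r, j) = 0"
      using Suc.IH[OF L(1) Suc_lessD[OF Suc.prems(2)] L(3)] by blast
    thus ?thesis using similar_mat_trans[OF L(2) N(3)] le_SucI[OF N(2)] by blast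
  qed
qed

text \<open>
  If every functional is an eigenvector, then every coordinate functional is, so \<open>A\<close> is diagonal; and
  sums of two coordinate functionals are, so the diagonal entries agree.
\<close>

lemma nonscalar_moves_functional:
  fixes A :: "'a :: field mat"
  assumes A: "A \<in> carrier_mat n n" and ns: "\<nexists>a. A = a \<cdot>\<^sub>m 1\<^sub>m n"
  shows "\<exists>w\<in>carrier_vec n. \<exists>q<n. w $ q \<noteq> 0 \<and> (\<forall>a. \<exists>j<n. w \<bullet> col A j \<noteq> a * w $ j)"
proof (cases "\<exists>i<n. \<exists>j<n. i \<noteq> j \<and> A $$ (i, j) \<noteq> 0")
  case True
  then obtain i j where ij: "i < n" "j < n" "i \<noteq> j" "A $$ (i, j) \<noteq> 0" by blast
  have "\<exists>j<n. unit_vec n i \<bullet> col A j \<noteq> a * unit_vec n i $ j" for a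
    using ij A by (intro exI[of _ j]) simp
  with ij show ?thesis by (intro bexI[of _ "unit_vec n i"] exI[of _ i]) simp_all
next
  case False
  have "\<exists>i<n. \<exists>j<n. A $$ (i, i) \<noteq> A $$ (j, j)"
  proof (rule ccontr)
    assume const: "\<not> ?thesis"
    define a where "a = A $$ (0, 0)"
    have "A $$ (i, j) = (a \<cdot>\<^sub>m 1\<^sub>m n) $$ (i, j)" if "i < n" "j < n" for i j
    proof (cases "i = j")
      case True
      have "0 < n" using that by simp
      with const that True have "A $$ (i, j) = a" unfolding a_def by blast
      thus ?thesis using that True by simp
    next
      case neq: False
      with that False have "A $$ (i, j) = 0" by blast
      with neq that show ?thesis by simp
    qed
    hence "A = a \<cdot>\<^sub>m 1\<^sub>m n" using A by (intro eq_matI) auto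
    thus False using ns by blast
  qed
  then obtain i j where ij: "i < n" "j < n" "A $$ (i, i) \<noteq> A $$ (j, j)" by blast
  define w where "w = (unit_vec n i + unit_vec n j :: 'a vec)"
  have "i \<noteq> j" using ij by auto
  have w: "w \<bullet> col A k = A $$ (i, k) + A $$ (j, k)" if "k < n" for k
    using ij A that by (simp add: w_def add_scalar_prod_distrib[of _ n])
  have off: "A $$ (i, j) = 0" "A $$ (j, i) = 0" using False ij \<open>i \<noteq> j\<close> by blast+
  have "\<exists>k<n. w \<bullet> col A k \<noteq> a * w $ k" for a
  proof (rule ccontr)
    assume "\<not> ?thesis"
    hence "w \<bullet> col A i = a * w $ i" "w \<bullet> col A j = a * w $ j" using ij by blast+
    moreover have "w $ i = 1" "w $ j = 1" using ij \<open>i \<noteq> j\<close> by (simp_all add: w_def)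
    ultimately show False using ij off by (simp add: w)
  qed
  thus ?thesis using ij \<open>i \<noteq> j\<close>
    by (intro bexI[of _ w] exI[of _ i]) (simp_all add: w_def)
qed

text \<open>
  A functional that is not an eigenvector is made the last member of the dual basis.
\<close>

lemma nonscalar_bottom_row:
  fixes A :: "'a :: field mat"
  assumes A: "A \<in> carrier_mat n n" and ns: "\<nexists>a. A = a \<cdot>\<^sub>m 1\<^sub>m n"
  shows "\<exists>M\<in>carrier_mat n n. similar_mat A M \<and> (\<exists>q<n - 1. M $$ (n - 1, q) \<noteq> 0)"
proof -
  obtain w r where w: "w \<in> carrier_vec n" "r < n" "w $ r \<noteq> 0"
    and mv: "\<forall>a. \<exists>j<n. w \<bullet> col A j \<noteq> a * w $ j"
    using nonscalar_moves_functional[OF A ns] by blast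
  have n: "n - 1 < n" using w by simp
  obtain Q R where Q: "Q \<in> carrier_mat n n" and R: "R \<in> carrier_mat n n"
    and QR: "Q * R = 1\<^sub>m n" "R * Q = 1\<^sub>m n" and Qw: "row Q (n - 1) = w"
    using extend_row_to_invertible[OF w(1,3,2) n] by metis
  define M where "M = Q * A * R"
  have M: "M \<in> carrier_mat n n" using Q A R by (simp add: M_def)
  have "M * Q = Q * A * (R * Q)"
    unfolding M_def by (rule assoc_mult_mat[OF mult_carrier_mat[OF Q A] R Q])
  hence MQ: "M * Q = Q * A" using QR Q A by simp
  have "\<exists>q<n - 1. M $$ (n - 1, q) \<noteq> 0"
  proof (rule ccontr)
    assume "\<not> ?thesis"
    hence M0: "row M (n - 1) = M $$ (n - 1, n - 1) \<cdot>\<^sub>v unit_vec n (n - 1)"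
      using M n by (intro eq_vecI) auto
    have "w \<bullet> col A j = M $$ (n - 1, n - 1) * w $ j" if j: "j < n" for j
    proof -
      have "w \<bullet> col A j = (Q * A) $$ (n - 1, j)" using j n Q A Qw by simp
      also have "\<dots> = row M (n - 1) \<bullet> col Q j" unfolding MQ[symmetric] using j n Q M by simp
      also have "\<dots> = M $$ (n - 1, n - 1) * w $ j"
        unfolding M0 using j n Q Qw[symmetric] by simp
      finally show ?thesis .
    qed
    thus False using mv by blast
  qed
  moreover have "similar_mat A M" unfolding M_def by (rule similar_mat_conj[OF A R Q QR(2,1)])
  ultimately show ?thesis using M by blast
qed

text \<open>
  The chain of functionals starts with the last two positions, so it has at least two members, and it
  is extended until it closes up.
\<close>

lemma nonscalar_similar_shift_rows:
  fixes A :: "'a :: field mat"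
  assumes A: "A \<in> carrier_mat n n" and ns: "\<nexists>a. A = a \<cdot>\<^sub>m 1\<^sub>m n"
  shows "\<exists>N\<in>carrier_mat n n. \<exists>r. r + 2 \<le> n \<and> similar_mat A N \<and> shift_rows_below n N r \<and>
    (\<forall>j<r. N $$ (r, j) = 0)"
proof -
  obtain M q where M: "M \<in> carrier_mat n n" "similar_mat A M" "q < n - 1" "M $$ (n - 1, q) \<noteq> 0"
    using nonscalar_bottom_row[OF A ns] by blast
  have n: "n - 1 = Suc (n - 2)" "Suc (n - 2) < n" "n - 2 < n" "q \<le> n - 2" using M(3) by auto
  have "shift_rows_below n M (Suc (n - 2))" by (auto simp: shift_rows_below_def)
  then obtain L where L: "L \<in> carrier_mat n n" "similar_mat M L" "shift_rows_below n L (n - 2)"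
    using extend_shift_rows[OF M(1) n(2,4) M(4)[unfolded n(1)]] by blast
  obtain N r where N: "N \<in> carrier_mat n n" "r \<le> n - 2" "similar_mat L N"
    "shift_rows_below n N r" "\<forall>j<r. N $$ (r, j) = 0"
    using complete_shift_rows[OF L(1) n(3) L(3)] by blast
  have "similar_mat A N"
    by (rule similar_mat_trans[OF M(2) similar_mat_trans[OF L(2) N(3)]])
  moreover have "r + 2 \<le> n" using N(2) n(2) by simp
  ultimately show ?thesis using N by blast
qed

section \<open>A chain as part of a basis\<close>

text \<open>
  The rows describe a cyclic quotient by dual vectors; appending a chain requires columns. The
  first \<open>p\<close> basis vectors are kept. Since \<open>M\<close> is a Hessenberg matrix with subdiagonal entries 1
  from index \<open>p\<close> on, the iterates under \<open>M\<close> of the \<open>p\<close>-th basis vector form a unitriangular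
  system, and this remains true if a combination of earlier basis vectors is subtracted from the
  last one: the combination of the first \<open>p\<close> vectors with coefficients \<open>v\<close>, and \<open>t\<close> times the vector
  at \<open>h\<close>.
\<close>

lemma chain_basis:
  fixes M :: "'a :: field mat" and v :: "nat \<Rightarrow> 'a"
  assumes M: "M \<in> carrier_mat n n" and n: "n = h + 2" and ph: "p \<le> h"
    and rows: "shift_rows_below n M p"
    and rowp: "\<And>j. j < p \<Longrightarrow> M $$ (p, j) = 0"
  obtains N where "N \<in> carrier_mat n n" "similar_mat M N"
    "\<And>i j. i < n \<Longrightarrow> j < p \<Longrightarrow> N $$ (i, j) = (if i < p then M $$ (i, j) else 0)"
    "\<And>i j. i < n \<Longrightarrow> p \<le> j \<Longrightarrow> j < h \<Longrightarrow> N $$ (i, j) = of_bool (i = Suc j)"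
    "\<And>i. i < n \<Longrightarrow> N $$ (i, h) =
      (if i < p then v i else t * of_bool (i = h) + of_bool (i = Suc h))"
proof -
  define g where "g k = ((*\<^sub>v) M ^^ k) (unit_vec n p)" for k
  have gS: "g (Suc k) = M *\<^sub>v g k" for k by (simp add: g_def)
  have gc: "g k \<in> carrier_vec n" for k
    by (induction k) (use M in \<open>auto simp: gS g_def\<close>)
  have Mi: "M $$ (i, j) = of_bool (j = i - 1)" if "p < i" "i < n" "j < n" for i j
    using arg_cong[OF shift_rows_belowD[OF rows that(1,2)], of "\<lambda>v. v $ j"] that M by auto
  have shift: "(M *\<^sub>v u) $ i = u $ (i - 1)" if "p < i" "i < n" "u \<in> carrier_vec n" for u i
    using that M shift_rows_belowD[OF rows that(1,2)] by simp
  have gtri: "g k $ i = of_bool (i = p + k)" if "p + k \<le> i" "i < n" for k i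
    using that
  proof (induction k arbitrary: i)
    case 0
    thus ?case by (simp add: g_def)
  next
    case (Suc k)
    thus ?case using shift[of i "g k"] gc[of k] by (auto simp: gS)
  qed
  define pc where "pc j = (if j < p then unit_vec n j else if j \<le> h then g (j - p)
      else M *\<^sub>v g (h - p) - vec n (\<lambda>i. if i < p then v i else 0) - t \<cdot>\<^sub>v g (h - p))" for j
  define P where "P = mat_of_cols n (map pc [0..<n])"
  have P: "P \<in> carrier_mat n n" by (simp add: P_def mat_of_cols_def)
  have pcc: "pc j \<in> carrier_vec n" for j using gc M by (simp add: pc_def)
  have colP: "col P j = pc j" if "j < n" for j using that pcc by (simp add: P_def)
  have Pij: "P $$ (i, j) = pc j $ i" if "i < n" "j < n" for i j
    using colP[OF that(2)] that P by (metis carrier_matD index_col)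
  have tri: "P $$ (i, j) = of_bool (i = j)" if "j \<le> i" "i < n" for i j
  proof -
    have "pc j $ i = of_bool (i = j)"
    proof (cases "j \<le> h")
      case True
      thus ?thesis using that gtri[of "j - p" i] by (auto simp: pc_def)
    next
      case False
      hence ij: "i = Suc h" "j = Suc h" using that n by auto
      have "(M *\<^sub>v g (h - p)) $ Suc h = 1"
        using shift[of "Suc h" "g (h - p)"] gc gtri[of "h - p" h] ph n by simp
      moreover have "g (h - p) $ Suc h = 0" using gtri[of "h - p" "Suc h"] ph n by simp
      ultimately show ?thesis using ij ph n gc[of "h - p"] M by (simp add: pc_def carrier_vecD)
    qed
    with Pij that show ?thesis by simp
  qed
  have "upper_triangular P" using tri P by (auto simp: upper_triangular_def)
  hence "det P = prod_list (diag_mat P)" by (rule det_upper_triangular[OF _ P])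
  also have "diag_mat P = map (\<lambda>_. 1) [0..<n]" using P tri by (auto simp: diag_mat_def)
  finally have "det P = 1" by (simp add: map_replicate_const)
  hence "P \<in> Units (ring_mat TYPE('a) n ())" by (intro det_non_zero_imp_unit[OF P]) simp
  then obtain R where R: "R \<in> carrier_mat n n" and PR: "P * R = 1\<^sub>m n" "R * P = 1\<^sub>m n"
    unfolding Units_def ring_mat_def by auto
  define N where "N = R * M * P"
  have N: "N \<in> carrier_mat n n" using R M P by (simp add: N_def)
  have sim: "similar_mat M N" unfolding N_def by (rule similar_mat_conj[OF M P R PR])
  have colN: "N $$ (i, j) = u $ i"
    if "j < n" "i < n" "u \<in> carrier_vec n" "M *\<^sub>v pc j = P *\<^sub>v u" for i j u
  proof -
    have "col N j = R * M *\<^sub>v pc j"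
      unfolding N_def colP[OF that(1), symmetric]
      by (rule col_mult2[of _ n n _ n]) (use R M P that(1) in auto)
    also have "\<dots> = R *\<^sub>v (P *\<^sub>v u)"
      unfolding that(4)[symmetric] by (rule assoc_mult_mat_vec[OF R M pcc])
    also have "\<dots> = (R * P) *\<^sub>v u" by (rule assoc_mult_mat_vec[OF R P that(3), symmetric])
    also have "\<dots> = u" using PR that(3) by simp
    finally show ?thesis using N that(1,2) by (metis carrier_matD index_col)
  qed
  have Pfix: "P *\<^sub>v u = u" if u: "u \<in> carrier_vec n" "\<And>i. p \<le> i \<Longrightarrow> i < n \<Longrightarrow> u $ i = 0" for u
  proof (rule eq_vecI)
    fix i assume "i < dim_vec u"
    hence i: "i < n" using u by auto
    have "(P *\<^sub>v u) $ i = (\<Sum>l\<in>{0..<n}. P $$ (i, l) * u $ l)"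
      using P u i by (simp add: scalar_prod_def)
    also have "\<dots> = (\<Sum>l\<in>{0..<n}. if l = i then u $ i else 0)"
    proof (rule sum.cong)
      fix l assume "l \<in> {0..<n}"
      thus "P $$ (i, l) * u $ l = (if l = i then u $ i else 0)"
        using Pij[of i l] i u(2)[of l] by (cases "l < p") (auto simp: pc_def)
    qed simp
    finally show "(P *\<^sub>v u) $ i = u $ i" using i by simp
  qed (use P u in auto)
  have mult_unit: "B *\<^sub>v unit_vec n j = col B j" if "B \<in> carrier_mat n n" "j < n" for B :: "'a mat" and j
    using that by (intro eq_vecI) auto
  have Punit: "P *\<^sub>v unit_vec n j = pc j" if "j < n" for j
    using mult_unit[OF P that] colP[OF that] by simp
  show thesis
  proof (rule that[OF N sim])
    fix i j assume ij: "i < n" "j < p"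
    have jn: "j < n" using ij ph n by simp
    have low: "M $$ (k, j) = 0" if "p \<le> k" "k < n" for k
      using that Mi[of k j] rowp[of j] ij jn by (cases "k = p") auto
    have "M *\<^sub>v pc j = col M j" using mult_unit[OF M jn] ij by (simp add: pc_def)
    also have "\<dots> = P *\<^sub>v col M j" using low M jn by (intro Pfix[symmetric]) auto
    finally have "N $$ (i, j) = col M j $ i" using M ij jn by (intro colN) auto
    thus "N $$ (i, j) = (if i < p then M $$ (i, j) else 0)" using low ij M jn by auto
  next
    fix i j assume ij: "i < n" "p \<le> j" "j < h"
    have "M *\<^sub>v pc j = pc (Suc j)" using ij by (simp add: pc_def gS[symmetric] Suc_diff_le)
    also have "\<dots> = P *\<^sub>v unit_vec n (Suc j)" using Punit[of "Suc j"] ij n by simp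
    finally have "N $$ (i, j) = unit_vec n (Suc j) $ i" using ij n by (intro colN) auto
    thus "N $$ (i, j) = of_bool (i = Suc j)" using ij n by auto
  next
    fix i assume i: "i < n"
    define u where "u = vec n (\<lambda>i. if i < p then v i else 0)"
    have u: "u \<in> carrier_vec n" by (simp add: u_def)
    have hn: "h < n" "Suc h < n" using n by auto
    have Pu: "P *\<^sub>v u = u" by (rule Pfix) (auto simp: u_def)
    have "P *\<^sub>v (u + t \<cdot>\<^sub>v unit_vec n h + unit_vec n (Suc h)) = u + t \<cdot>\<^sub>v pc h + pc (Suc h)"
      using P u Punit[OF hn(1)] Punit[OF hn(2)]
      by (simp add: mult_add_distrib_mat_vec[of _ n n] mult_mat_vec[of _ n n] Pu
          assoc_add_vec[of _ n] pcc)
    also have "\<dots> = M *\<^sub>v pc h"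
      using M u gc[of "h - p"] ph by (intro eq_vecI) (auto simp: pc_def simp flip: u_def)
    finally have "N $$ (i, h) = (u + t \<cdot>\<^sub>v unit_vec n h + unit_vec n (Suc h)) $ i"
      using i hn u by (intro colN) auto
    thus "N $$ (i, h) = (if i < p then v i else t * of_bool (i = h) + of_bool (i = Suc h))"
      using i hn ph by (auto simp: u_def)
  qed
qed

section \<open>Every matrix is similar to a linked one\<close>

lemma linking_cong:
  assumes link: "linking n M c S e t"
    and eq: "\<And>i j. i < n \<Longrightarrow> j < n \<Longrightarrow> M i j = N i j"
  shows "linking n N c S e t"
proof -
  have "\<forall>i<n. \<forall>j<n. c i = c j \<longrightarrow> N i j = S i j + t * e i * e j"
    using linkingD(6)[OF link] eq by simp
  with link show ?thesis
    unfolding linking_def by (elim conjE, intro conjI) assumption+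
qed

text \<open>
  The induction splits off a cyclic quotient. The leading block is first brought to its linked form,
  which leaves the rows of the quotient unchanged; only then are the values known by which the last
  vector of the chain has to be corrected.
\<close>

lemma similar_to_linked:
  fixes A :: "'a :: field mat"
  assumes two: "(2 :: 'a) = 0" and "A \<in> carrier_mat n n"
  shows "\<exists>M c S e t. similar_mat A M \<and> linking n (\<lambda>i j. M $$ (i, j)) c S e t"
  using assms(2)
proof (induction n arbitrary: A rule: less_induct)
  case (less n)
  note A = less.prems
  show ?case
  proof (cases "\<exists>a. A = a \<cdot>\<^sub>m 1\<^sub>m n")
    case True
    then obtain a where a: "A = a \<cdot>\<^sub>m 1\<^sub>m n" by blast
    obtain c S e t where "linking n (\<lambda>i j. a * of_bool (i = j)) c S e t"
      using linking_scalar[OF two] by blast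
    hence "linking n (\<lambda>i j. A $$ (i, j)) c S e t"
      by (rule linking_cong) (simp add: a)
    thus ?thesis using similar_mat_refl[OF A] by blast
  next
    case False
    from nonscalar_similar_shift_rows[OF A this] obtain N r
      where r: "r + 2 \<le> n" and N: "N \<in> carrier_mat n n" and AN: "similar_mat A N"
        and rows: "shift_rows_below n N r" and row_r: "\<forall>j<r. N $$ (r, j) = 0" by blast
    define h where "h = n - 2"
    have n: "n = h + 2" and rh: "r \<le> h" using r by (auto simp: h_def)
    have Nij: "N $$ (i, j) = of_bool (j = i - 1)" if "r < i" "i < n" "j < n" for i j
      using arg_cong[OF shift_rows_belowD[OF rows that(1,2)], of "\<lambda>v. v $ j"] that N by auto
    define B where "B = mat r r (\<lambda>(i, j). N $$ (i, j))"
    define X where "X = mat r (n - r) (\<lambda>(i, j). N $$ (i, j + r))"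
    define D where "D = mat (n - r) (n - r) (\<lambda>(i, j). N $$ (i + r, j + r))"
    have B: "B \<in> carrier_mat r r" and X: "X \<in> carrier_mat r (n - r)"
      and D: "D \<in> carrier_mat (n - r) (n - r)" by (simp_all add: B_def X_def D_def)
    have low: "N $$ (i, j) = 0" if "r \<le> i" "i < n" "j < r" for i j
      using that Nij[of i j] row_r by (cases "i = r") auto
    have Nblock: "N = four_block_mat B X (0\<^sub>m (n - r) r) D"
      using N r low by (intro eq_matI) (auto simp: B_def X_def D_def)
    have "r < n" using r by simp
    from less.IH[OF this B] obtain M c S e t
      where BM: "similar_mat B M" and link: "linking r (\<lambda>i j. M $$ (i, j)) c S e t" by blast
    have M: "M \<in> carrier_mat r r"
      using similar_matD[OF BM] B by auto
    obtain Y where Y: "Y \<in> carrier_mat r (n - r)"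
      and sim: "similar_mat N (four_block_mat M Y (0\<^sub>m (n - r) r) D)"
      using similar_mat_four_block_0_ex[OF BM similar_mat_refl[OF D] X B D] Nblock by metis
    define K where "K = four_block_mat M Y (0\<^sub>m (n - r) r) D"
    have K: "K \<in> carrier_mat n n" using M D r by (auto simp: K_def)
    have Kij: "K $$ (i, j) = N $$ (i, j)" if "r \<le> i" "i < n" "j < n" for i j
      using that M Y D low by (auto simp: K_def D_def)
    have KM: "K $$ (i, j) = M $$ (i, j)" if "i < r" "j < r" for i j
      using that M D by (simp add: K_def)
    have "row K i = unit_vec n (i - 1)" if "r < i" "i < n" for i
      using that K Kij[of i] Nij[of i] by (intro eq_vecI) auto
    hence Krows: "shift_rows_below n K r" by (simp add: shift_rows_below_def)
    have Krow_r: "K $$ (r, j) = 0" if "j < r" for j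
      using that Kij[of r j] row_r r by auto
    obtain L where L: "L \<in> carrier_mat n n" and KL: "similar_mat K L"
      and L1: "\<And>i j. i < n \<Longrightarrow> j < r \<Longrightarrow> L $$ (i, j) = (if i < r then K $$ (i, j) else 0)"
      and L2: "\<And>i j. i < n \<Longrightarrow> r \<le> j \<Longrightarrow> j < h \<Longrightarrow> L $$ (i, j) = of_bool (i = Suc j)"
      and L3: "\<And>i. i < n \<Longrightarrow> L $$ (i, h) =
        (if i < r then \<Sum>l<r. S i l * e l else t * of_bool (i = h) + of_bool (i = Suc h))"
      by (rule chain_basis[OF K n rh Krows Krow_r, where v = "\<lambda>i. \<Sum>l<r. S i l * e l" and t = t]) blast+
    have "\<exists>c' S' e' t'. linking (h + 2) (\<lambda>i j. L $$ (i, j)) c' S' e' t'"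
      by (rule linking_append_chain[OF two link rh]) (use L1 L2 L3 KM rh n in auto)
    moreover have "similar_mat A L"
      using AN sim KL similar_mat_trans unfolding K_def by blast
    ultimately show ?thesis unfolding n by blast
  qed
qed

section \<open>Three square-zero summands\<close>

lemma mat_trace_mult_commute:
  fixes A B :: "'a :: comm_semiring_0 mat"
  assumes "A \<in> carrier_mat n n" "B \<in> carrier_mat n n"
  shows "mat_trace (A * B) = mat_trace (B * A)"
proof -
  have tr: "mat_trace (C * D) = (\<Sum>i<n. \<Sum>l<n. C $$ (i, l) * D $$ (l, i))"
    if "C \<in> carrier_mat n n" "D \<in> carrier_mat n n" for C D :: "'a mat"
    using that by (auto simp: mat_trace_def scalar_prod_def atLeast0LessThan)
  show ?thesis
    unfolding tr[OF assms] tr[OF assms(2,1)]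
    by (subst sum.swap) (simp add: mult.commute)
qed

lemma square_zero_mat_conj:
  fixes S :: "'a :: semiring_1 mat"
  assumes S: "square_zero_mat n S" and P: "P \<in> carrier_mat n n" and Q: "Q \<in> carrier_mat n n"
    and QP: "Q * P = 1\<^sub>m n"
  shows "square_zero_mat n (P * S * Q)"
proof -
  have Sc: "S \<in> carrier_mat n n" and SS: "S * S = 0\<^sub>m n n"
    using S by (auto simp: square_zero_mat_def)
  have "(P * S * Q) * (P * S * Q) = P * (S * ((Q * P) * (S * Q)))"
    using P Q Sc by (simp add: assoc_mult_mat[of _ n n _ n _ n])
  also have "\<dots> = P * ((S * S) * Q)"
    using P Q Sc by (simp add: QP assoc_mult_mat[of _ n n _ n _ n])
  also have "\<dots> = 0\<^sub>m n n" using P Q by (simp add: SS)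
  finally show ?thesis using P Q Sc by (simp add: square_zero_mat_def)
qed

theorem theorem1p3:
  fixes A :: "'a :: field mat" and n :: nat
  assumes "CHAR('a) = 2"
    and "n > 0"
    and "A \<in> carrier_mat n n"
    and "mat_trace A = 0"
  shows "\<exists>S\<^sub>1 S\<^sub>2 S\<^sub>3. square_zero_mat n S\<^sub>1 \<and> square_zero_mat n S\<^sub>2 \<and> square_zero_mat n S\<^sub>3 \<and>
    A = S\<^sub>1 + S\<^sub>2 + S\<^sub>3"
proof -
  have two: "(2 :: 'a) = 0"
    using of_nat_CHAR[where 'a = 'a] assms(1) by simp
  obtain M c S e t where "similar_mat A M"
    and link: "linking n (\<lambda>i j. M $$ (i, j)) c S e t"
    using similar_to_linked[OF two assms(3)] by blast
  then obtain P Q where wit: "similar_mat_wit A M P Q" by (auto simp: similar_mat_def)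
  note PQ = similar_mat_witD2[OF assms(3) wit]
  have "mat_trace A = mat_trace (Q * (P * M))"
    unfolding PQ(3) using PQ by (intro mat_trace_mult_commute) auto
  also have "Q * (P * M) = (Q * P) * M"
    by (rule assoc_mult_mat[OF PQ(7,6,5), symmetric])
  also have "\<dots> = M" using PQ(2,5) by simp
  also have "mat_trace M = t"
    using linking_trace[OF link] PQ(5) by (simp add: mat_trace_def)
  finally have "t = 0" using assms(4) by simp
  hence same: "M $$ (i, j) = S i j" if "i < n" "j < n" "c i = c j" for i j
    using linkingD(6)[OF link that] by simp
  \<comment> \<open>\<open>T True\<close> maps the \<open>H\<close>-vectors to the span of the \<open>E\<close>-vectors, and \<open>T False\<close> conversely.\<close>
  define T where "T b = mat n n (\<lambda>(i, j). if c i = b \<and> c j \<noteq> b then M $$ (i, j) - S i j else 0)" for b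
  define U where "U = mat n n (\<lambda>(i, j). S i j)"
  have U: "square_zero_mat n U"
    using linkingD(1)[OF link]
    by (auto simp: square_zero_mat_def U_def scalar_prod_def atLeast0LessThan intro!: eq_matI)
  have T: "square_zero_mat n (T b)" for b
    by (auto simp: square_zero_mat_def T_def scalar_prod_def intro!: eq_matI sum.neutral)
  have carrier: "U \<in> carrier_mat n n" "T b \<in> carrier_mat n n" for b
    by (simp_all add: U_def T_def)
  have "M = U + T True + T False"
    using PQ(5) same by (intro eq_matI) (auto simp: U_def T_def)
  hence "A = P * (U + T True + T False) * Q" using PQ(3) by simp
  moreover have "P * (X + Y) * Q = P * X * Q + P * Y * Q"
    if "X \<in> carrier_mat n n" "Y \<in> carrier_mat n n" for X Y
    unfolding mult_add_distrib_mat[OF PQ(6) that]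
    by (rule add_mult_distrib_mat[OF _ _ PQ(7)]) (use PQ(6) that in auto)
  ultimately have "A = P * U * Q + P * T True * Q + P * T False * Q"
    using carrier by (simp del: assoc_add_mat)
  thus ?thesis
    using square_zero_mat_conj[OF U PQ(6,7,2)] square_zero_mat_conj[OF T PQ(6,7,2)] by blast
qed

end
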